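(* Let $L$ be a vector space over a field $\mathbb{K}$, let $(L,[-,-,-]_1)$ and $(L,[-,-,-]_2)$ be ternary Leibniz algebras, and let $\beta_1,\beta_2:L\to L$ be injective linear maps with $\beta_1\beta_2=\beta_2\beta_1$ such that $\beta_i$ is an averaging operator on $(L,[-,-,-]_i)$ for $i=1,2$. Assume that $$[\beta_1(x),\beta_1(y),\beta_1(z)]_1=[\beta_2(x),\beta_2(y),\beta_2(z)]_2$$ for all $x,y,z\in L$. Define $[x,y,z]_{\beta_i}:=[\beta_i(x),\beta_i(y),z]_i$ for $i=1,2$. Then $(L,[-,-,-]_{\beta_1},[-,-,-]_{\beta_2})$ is a compatible ternary Leibniz algebra.
   Context: A ternary Leibniz algebra is a vector space $L$ with a trilinear bracket satisfying $[[x,y,z],t,u]=[x,y,[z,t,u]]+[x,[y,t,u],z]+[[x,t,u],y,z]$ for all $x,y,z,t,u\in L$. An averaging operator on it is a linear map $\beta:L\to L$ with $\beta([\beta(x),\beta(y),z])=\beta([\beta(x),y,\beta(z)])=\beta([x,\beta(y),\beta(z)])=[\beta(x),\beta(y),\beta(z)]$ for all $x,y,z$. A compatible ternary Leibniz algebra is a triple $(L,[-,-,-]_1,[-,-,-]_2)$ such that both brackets are ternary Leibniz and, for all $x,y,z,t,u\in L$, \begin{align*} [[x,y,z]_1,t,u]_2+[[x,y,z]_2,t,u]_1&=[x,y,[z,t,u]_1]_2+[x,y,[z,t,u]_2]_1+[x,[y,t,u]_1,z]_2\\ &\quad+[x,[y,t,u]_2,z]_1+[[x,t,u]_1,y,z]_2+[[x,t,u]_2,y,z]_1.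 \end{align*} *)

theory Defs
  imports Complex_Main
begin

definition trilinear ::
  "('k::field \<Rightarrow> 'v::ab_group_add \<Rightarrow> 'v) \<Rightarrow> ('v \<Rightarrow> 'v \<Rightarrow> 'v \<Rightarrow> 'v) \<Rightarrow> bool" where
  "trilinear scale br \<longleftrightarrow>
     (\<forall>y z. Vector_Spaces.linear scale scale (\<lambda>x. br x y z)) \<and>
     (\<forall>x z. Vector_Spaces.linear scale scale (\<lambda>y. br x y z)) \<and>
     (\<forall>x y. Vector_Spaces.linear scale scale (\<lambda>z. br x y z))"

definition ternary_leibniz_algebra ::
  "('k::field \<Rightarrow> 'v::ab_group_add \<Rightarrow> 'v) \<Rightarrow> ('v \<Rightarrow> 'v \<Rightarrow> 'v \<Rightarrow> 'v) \<Rightarrow> bool" where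
  "ternary_leibniz_algebra scale br \<longleftrightarrow>
     vector_space scale \<and> trilinear scale br \<and>
     (\<forall>x y z t u. br (br x y z) t u =
        br x y (br z t u) + br x (br y t u) z + br (br x t u) y z)"

definition averaging_operator ::
  "('k::field \<Rightarrow> 'v::ab_group_add \<Rightarrow> 'v) \<Rightarrow> ('v \<Rightarrow> 'v \<Rightarrow> 'v \<Rightarrow> 'v) \<Rightarrow> ('v \<Rightarrow> 'v) \<Rightarrow> bool" where
  "averaging_operator scale br \<beta> \<longleftrightarrow>
     Vector_Spaces.linear scale scale \<beta> \<and>
     (\<forall>x y z. \<beta> (br (\<beta> x) (\<beta> y) z) = \<beta> (br (\<beta> x) y (\<beta> z)) \<and>
              \<beta> (br (\<beta> x) y (\<beta> z)) = \<beta> (br x (\<beta> y) (\<beta> z)) \<and>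
              \<beta> (br x (\<beta> y) (\<beta> z)) = br (\<beta> x) (\<beta> y) (\<beta> z))"

definition compatible_ternary_leibniz_algebra ::
  "('k::field \<Rightarrow> 'v::ab_group_add \<Rightarrow> 'v) \<Rightarrow> ('v \<Rightarrow> 'v \<Rightarrow> 'v \<Rightarrow> 'v) \<Rightarrow> ('v \<Rightarrow> 'v \<Rightarrow> 'v \<Rightarrow> 'v) \<Rightarrow> bool"
  where
  "compatible_ternary_leibniz_algebra scale br1 br2 \<longleftrightarrow>
     ternary_leibniz_algebra scale br1 \<and> ternary_leibniz_algebra scale br2 \<and>
     (\<forall>x y z t u.
        br2 (br1 x y z) t u + br1 (br2 x y z) t u =
          br2 x y (br1 z t u) + br1 x y (br2 z t u) + br2 x (br1 y t u) z
          + br1 x (br2 y t u) z + br2 (br1 x t u) y z + br1 (br2 x t u) y z)"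

definition averaged_bracket ::
  "('v \<Rightarrow> 'v \<Rightarrow> 'v \<Rightarrow> 'v) \<Rightarrow> ('v \<Rightarrow> 'v) \<Rightarrow> 'v \<Rightarrow> 'v \<Rightarrow> 'v \<Rightarrow> 'v" where
  "averaged_bracket br \<beta> x y z = br (\<beta> x) (\<beta> y) z"

end

theory Submission
  imports Defs
begin

text \<open>
  Write \<open>M\<^sub>i\<close> for the averaged bracket of \<open>\<beta>\<^sub>i\<close>. By the averaging identities,
  \<open>\<beta>\<^sub>i\<close> is a homomorphism from \<open>M\<^sub>i\<close> to the original bracket, \<open>\<beta>\<^sub>i (M\<^sub>i x y z) = [\<beta>\<^sub>i x, \<beta>\<^sub>i y, \<beta>\<^sub>i z]\<^sub>i\<close>.
  The hypothesis that the two brackets agree along \<open>\<beta>\<^sub>1\<close> and \<open>\<beta>\<^sub>2\<close> therefore says that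
  \<open>\<beta>\<^sub>2 (M\<^sub>2 x y z)\<close> also equals \<open>[\<beta>\<^sub>1 x, \<beta>\<^sub>1 y, \<beta>\<^sub>1 z]\<^sub>1\<close>.

  Hence \<open>\<beta>\<^sub>2 (M\<^sub>2 (M\<^sub>1 x y z) t u) = [[\<beta>\<^sub>1 x, \<beta>\<^sub>1 y, \<beta>\<^sub>1 z]\<^sub>1, \<beta>\<^sub>1 t, \<beta>\<^sub>1 u]\<^sub>1\<close>, and likewise for every other
  nesting of \<open>M\<^sub>1\<close> inside \<open>M\<^sub>2\<close>. Applying the Leibniz identity of the first bracket and cancelling
  the injective map \<open>\<beta>\<^sub>2\<close> yields a Leibniz identity for \<open>M\<^sub>1\<close> nested inside \<open>M\<^sub>2\<close>. By symmetry the same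
  holds for \<open>M\<^sub>2\<close> nested inside \<open>M\<^sub>1\<close>, and compatibility is the sum of these two identities. So
  the mixed identity splits into two halves, each of which holds separately. The Leibniz identity of
  a single \<open>M\<^sub>i\<close> is the same argument with both brackets equal to \<open>M\<^sub>i\<close>. This common argument is the
  lemma \<open>nested_leibniz_pullback\<close>.
\<close>

lemma averaging_operator_hom:
  assumes "averaging_operator scale br \<beta>"
  shows "\<beta> (averaged_bracket br \<beta> x y z) = br (\<beta> x) (\<beta> y) (\<beta> z)"
  using assms unfolding averaging_operator_def averaged_bracket_def by metis

lemma trilinear_averaged_bracket:
  assumes "trilinear scale br" and "Vector_Spaces.linear scale scale \<beta>"
  shows "trilinear scale (averaged_bracket br \<beta>)"
proof -
  have "Vector_Spaces.linear scale scale (\<lambda>x. br (\<beta> x) (\<beta> y) z)"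
    and "Vector_Spaces.linear scale scale (\<lambda>y. br (\<beta> x) (\<beta> y) z)"
    and "Vector_Spaces.linear scale scale (\<lambda>z. br (\<beta> x) (\<beta> y) z)" for x y z
    using assms(1)
      Vector_Spaces.linear_compose[OF assms(2), of scale "\<lambda>x. br x (\<beta> y) z"]
      Vector_Spaces.linear_compose[OF assms(2), of scale "\<lambda>y. br (\<beta> x) y z"]
    unfolding trilinear_def o_def by blast+
  then show ?thesis
    unfolding trilinear_def averaged_bracket_def by blast
qed

text \<open>
  Every term of the identity is sent by the injective map \<open>\<phi>\<close> to the corresponding term of the
  Leibniz identity of \<open>br\<close> at the images under \<open>\<beta>\<close>: the outer bracket \<open>N\<close> becomes \<open>br\<close> by passing
  through \<open>\<phi>\<close>, which puts a \<open>\<beta>\<close> in front of the inner bracket \<open>M\<close>, and that \<open>\<beta>\<close> turns \<open>M\<close> into \<open>br\<close>.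
  Keeping \<open>N\<close> and \<open>\<phi>\<close> distinct from \<open>M\<close> and \<open>\<beta>\<close> lets one statement cover both the Leibniz identity
  of an averaged bracket and each half of the compatibility condition.
\<close>

lemma nested_leibniz_pullback:
  assumes leibniz: "ternary_leibniz_algebra scale br"
    and linear: "Vector_Spaces.linear scale scale \<phi>" and inj: "inj \<phi>"
    and inner: "\<And>x y z. \<beta> (M x y z) = br (\<beta> x) (\<beta> y) (\<beta> z)"
    and outer: "\<And>x y z. \<phi> (N x y z) = br (\<beta> x) (\<beta> y) (\<beta> z)"
  shows "N (M x y z) t u = N x y (M z t u) + N x (M y t u) z + N (M x t u) y z"
proof (rule injD[OF inj])
  have "br (br (\<beta> x) (\<beta> y) (\<beta> z)) (\<beta> t) (\<beta> u) =
      br (\<beta> x) (\<beta> y) (br (\<beta> z) (\<beta> t) (\<beta> u)) + br (\<beta> x) (br (\<beta> y) (\<beta> t) (\<beta> u)) (\<beta> z)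
      + br (br (\<beta> x) (\<beta> t) (\<beta> u)) (\<beta> y) (\<beta> z)"
    using leibniz unfolding ternary_leibniz_algebra_def by blast
  then show "\<phi> (N (M x y z) t u) = \<phi> (N x y (M z t u) + N x (M y t u) z + N (M x t u) y z)"
    by (simp only: module_hom.add[OF Vector_Spaces.linear.axioms(3)[OF linear]] outer inner)
qed

lemma ternary_leibniz_algebra_averaged_bracket:
  assumes "ternary_leibniz_algebra scale br"
    and "averaging_operator scale br \<beta>" and "inj \<beta>"
  shows "ternary_leibniz_algebra scale (averaged_bracket br \<beta>)"
proof -
  have linear: "Vector_Spaces.linear scale scale \<beta>"
    using assms(2) unfolding averaging_operator_def by blast
  note hom = averaging_operator_hom[OF assms(2)]
  show ?thesis
    using assms(1) trilinear_averaged_bracket[OF _ linear]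
      nested_leibniz_pullback[where \<beta> = \<beta> and M = "averaged_bracket br \<beta>"
        and N = "averaged_bracket br \<beta>", OF assms(1) linear assms(3) hom hom]
    unfolding ternary_leibniz_algebra_def by blast
qed

theorem proposition2p7:
  fixes scale :: "'k::field \<Rightarrow> 'v::ab_group_add \<Rightarrow> 'v"
    and br1 br2 :: "'v \<Rightarrow> 'v \<Rightarrow> 'v \<Rightarrow> 'v"
    and \<beta>1 \<beta>2 :: "'v \<Rightarrow> 'v"
  assumes "vector_space scale"
    and "ternary_leibniz_algebra scale br1"
    and "ternary_leibniz_algebra scale br2"
    and "Vector_Spaces.linear scale scale \<beta>1" and "inj \<beta>1"
    and "Vector_Spaces.linear scale scale \<beta>2" and "inj \<beta>2"
    and "\<beta>1 \<circ> \<beta>2 = \<beta>2 \<circ> \<beta>1"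
    and "averaging_operator scale br1 \<beta>1"
    and "averaging_operator scale br2 \<beta>2"
    and "\<forall>x y z. br1 (\<beta>1 x) (\<beta>1 y) (\<beta>1 z) = br2 (\<beta>2 x) (\<beta>2 y) (\<beta>2 z)"
  shows "compatible_ternary_leibniz_algebra scale
           (averaged_bracket br1 \<beta>1) (averaged_bracket br2 \<beta>2)"
proof -
  let ?M1 = "averaged_bracket br1 \<beta>1" and ?M2 = "averaged_bracket br2 \<beta>2"
  note hom1 = averaging_operator_hom[OF assms(9)]
    and hom2 = averaging_operator_hom[OF assms(10)]
  have cross2: "\<beta>2 (?M2 x y z) = br1 (\<beta>1 x) (\<beta>1 y) (\<beta>1 z)" for x y z
    by (simp add: hom2 assms(11))
  have cross1: "\<beta>1 (?M1 x y z) = br2 (\<beta>2 x) (\<beta>2 y) (\<beta>2 z)" for x y z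
    by (simp add: hom1 assms(11))
  have half21: "?M2 (?M1 x y z) t u = ?M2 x y (?M1 z t u) + ?M2 x (?M1 y t u) z + ?M2 (?M1 x t u) y z"
    for x y z t u
    by (rule nested_leibniz_pullback[where \<beta> = \<beta>1 and M = ?M1 and N = ?M2, OF assms(2,6,7) hom1 cross2])
  have half12: "?M1 (?M2 x y z) t u = ?M1 x y (?M2 z t u) + ?M1 x (?M2 y t u) z + ?M1 (?M2 x t u) y z"
    for x y z t u
    by (rule nested_leibniz_pullback[where \<beta> = \<beta>2 and M = ?M2 and N = ?M1, OF assms(3,4,5) hom2 cross1])
  have "?M2 (?M1 x y z) t u + ?M1 (?M2 x y z) t u =
      ?M2 x y (?M1 z t u) + ?M1 x y (?M2 z t u) + ?M2 x (?M1 y t u) z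
      + ?M1 x (?M2 y t u) z + ?M2 (?M1 x t u) y z + ?M1 (?M2 x t u) y z" for x y z t u
    unfolding half21[of x y z t u] half12[of x y z t u] by (simp only: ac_simps)
  then show ?thesis
    unfolding compatible_ternary_leibniz_algebra_def
    using ternary_leibniz_algebra_averaged_bracket[OF assms(2,9,5)]
      ternary_leibniz_algebra_averaged_bracket[OF assms(3,10,7)]
    by blast
qed

end
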